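(* Let $S$ and $A$ be finite nonempty sets. Every deterministic policy $\pi$ (a transducer from $S$ to $A$) is specifiable, i.e. there exists a teleo-environment $\varepsilon$ (a transducer from $A$ to $S\times\{\bot,\top\}$) for which $\pi$ is uniquely optimal. Furthermore, every specifiable policy is deterministic.
   Context: Transducers. Let $I,O$ be finite sets. A transducer $\tau$ from $I$ to $O$ is (coinductively) a probability distribution $p_\tau$ on $O$ together with, for each $i\in I$ and each $o\in O$ with $p_\tau(o)>0$, another transducer $\tau\bullet(i,o)$ from $I$ to $O$, called "$\tau$ evolved by $(i,o)$". (The output distribution does not depend on the simultaneously received input.) For a finite sequence $h=((i_1,o_1),\dots,(i_n,o_n))$, $n\ge 0$, say that $h$ is possible for $\tau$ if each $o_k$ has positive probability under the output distribution of $\tau\bullet(i_1,o_1)\bullet\cdots\bullet(i_{k-1},o_{k-1})$; then $\tau\bullet h$ denotes the iterated evolution. Two transducers are equal iff they have the same output distributions after every possible sequence $h$ (including the empty one). A transducer $\tau$ is deterministic if, for every $h$ possible for $\tau$, the output distribution $p_{\tau\bullet h}$ is a point mass. Policies and teleo-environments. $S$ is the set of sensor values and $A$ the set of actions. A policy is a transducer from $S$ to $A$. A teleo-environment is a transducer from $A$ to $S\times\{\bot,\top\}$, where $\top$ is the success signal and $\bot$ the lack-of-success signal; the success signal is not observed by the policy. Coupling. Given a policy $\pi$ and a teleo-environment $\varepsilon$, put $\pi_1=\pi$, $\varepsilon_1=\varepsilon$. At each time step $t=1,2,\dots$ an action $a_t\sim p_{\pi_t}$ and a pair $(s_t,r_t)\sim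 p_{\varepsilon_t}$ are drawn independently of each other (given the past), and then $\pi_{t+1}=\pi_t\bullet(s_t,a_t)$ and $\varepsilon_{t+1}=\varepsilon_t\bullet(a_t,(s_t,r_t))$. Let $V(\pi,\varepsilon)$ be the probability that $r_t=\top$ for at least one $t\ge 1$. Optimality. A policy $\pi$ is optimal for $\varepsilon$ if $V(\pi,\varepsilon)\ge V(\pi',\varepsilon)$ for every policy $\pi'$. It is uniquely optimal for $\varepsilon$ if it is optimal for $\varepsilon$ and no other policy is optimal for $\varepsilon$. A policy is specifiable if there is a teleo-environment for which it is uniquely optimal. *)

theory Defs
  imports "HOL-Probability.Probability"
begin

text \<open>
  The evolution is a partial function; \<open>wf_pretransducer\<close> makes its domain exactly the
  pairs \<open>(i, o)\<close> for which \<open>o\<close> has positive probability, hereditarily. So a transducer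
  carries no data for outputs of probability zero, and HOL equality on the type is the
  intended equality (lemma \<open>transducer_eq_iff\<close>).
\<close>

codatatype ('i, 'o) pretransducer =
  Pretransducer (pre_out: "'o pmf") (pre_evolve: "'i \<Rightarrow> 'o \<Rightarrow> ('i, 'o) pretransducer option")

coinductive wf_pretransducer :: "('i, 'o) pretransducer \<Rightarrow> bool" where
  "\<lbrakk>\<And>i o'. pre_evolve t i o' \<noteq> None \<longleftrightarrow> pmf (pre_out t) o' > 0;
    \<And>i o' t'. pre_evolve t i o' = Some t' \<Longrightarrow> wf_pretransducer t'\<rbrakk>
   \<Longrightarrow> wf_pretransducer t"

primcorec const_pretransducer :: "'o pmf \<Rightarrow> ('i, 'o) pretransducer" where
  "const_pretransducer p =
     Pretransducer p (\<lambda>i o'. if pmf p o' > 0 then Some (const_pretransducer p) else None)"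

lemma wf_const_pretransducer: "wf_pretransducer (const_pretransducer p)"
proof (coinduction rule: wf_pretransducer.coinduct)
  case wf_pretransducer
  then show ?case by (auto split: if_splits)
qed

typedef ('i, 'o) transducer = "{t :: ('i, 'o) pretransducer. wf_pretransducer t}"
  using wf_const_pretransducer by blast

definition out :: "('i, 'o) transducer \<Rightarrow> 'o pmf" where
  "out \<tau> = pre_out (Rep_transducer \<tau>)"

text \<open>The value of \<open>evolve \<tau> (i, o)\<close> is unspecified if \<open>o\<close> has probability zero.\<close>

definition evolve :: "('i, 'o) transducer \<Rightarrow> 'i \<times> 'o \<Rightarrow> ('i, 'o) transducer" where
  "evolve \<tau> = (\<lambda>(i, o'). Abs_transducer (the (pre_evolve (Rep_transducer \<tau>) i o')))"

definition evolves :: "('i, 'o) transducer \<Rightarrow> ('i \<times> 'o) list \<Rightarrow> ('i, 'o) transducer" where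
  "evolves \<tau> h = foldl evolve \<tau> h"

definition possible :: "('i, 'o) transducer \<Rightarrow> ('i \<times> 'o) list \<Rightarrow> bool" where
  "possible \<tau> h \<longleftrightarrow> (\<forall>k < length h. pmf (out (evolves \<tau> (take k h))) (snd (h ! k)) > 0)"

definition deterministic :: "('i, 'o) transducer \<Rightarrow> bool" where
  "deterministic \<tau> \<longleftrightarrow> (\<forall>h. possible \<tau> h \<longrightarrow> (\<exists>o'. out (evolves \<tau> h) = return_pmf o'))"

lemma possible_Nil: "possible \<tau> []"
  by (simp add: possible_def)

lemma possible_Cons:
  "possible \<tau> (x # h) \<longleftrightarrow> pmf (out \<tau>) (snd x) > 0 \<and> possible (evolve \<tau> x) h"
  by (auto simp: possible_def evolves_def nth_Cons less_Suc_eq_0_disj split: nat.splits)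

lemma pre_evolve_Rep:
  assumes "pmf (out \<tau>) o' > 0"
  shows "pre_evolve (Rep_transducer \<tau>) i o' = Some (Rep_transducer (evolve \<tau> (i, o')))"
proof -
  have wf: "wf_pretransducer (Rep_transducer \<tau>)"
    using Rep_transducer by blast
  then obtain t' where t': "pre_evolve (Rep_transducer \<tau>) i o' = Some t'"
    using assms by (cases rule: wf_pretransducer.cases) (metis not_None_eq out_def)
  moreover have "wf_pretransducer t'"
    using wf t' by (auto elim: wf_pretransducer.cases)
  ultimately show ?thesis
    by (simp add: evolve_def Abs_transducer_inverse)
qed

lemma pre_evolve_Rep_None:
  assumes "pmf (out \<tau>) o' = 0"
  shows "pre_evolve (Rep_transducer \<tau>) i o' = None"
proof -
  have "wf_pretransducer (Rep_transducer \<tau>)"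
    using Rep_transducer by blast
  then show ?thesis
    using assms by (cases rule: wf_pretransducer.cases) (metis less_irrefl out_def)
qed

lemma transducer_eq_iff:
  "\<sigma> = \<tau> \<longleftrightarrow> (\<forall>h. possible \<sigma> h \<longrightarrow> possible \<tau> h \<longrightarrow> out (evolves \<sigma> h) = out (evolves \<tau> h))"
  (is "_ \<longleftrightarrow> ?E \<sigma> \<tau>")
proof
  assume "?E \<sigma> \<tau>"
  then have "Rep_transducer \<sigma> = Rep_transducer \<tau>"
  proof (coinduction arbitrary: \<sigma> \<tau> rule: pretransducer.coinduct)
    case (Eq_pretransducer \<sigma> \<tau>)
    have out: "out \<sigma> = out \<tau>"
      using Eq_pretransducer[rule_format, of "[]"] by (simp add: possible_Nil evolves_def)
    have "rel_option (\<lambda>s t. \<exists>\<sigma> \<tau>. s = Rep_transducer \<sigma> \<and> t = Rep_transducer \<tau> \<and> ?E \<sigma> \<tau>)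
        (pre_evolve (Rep_transducer \<sigma>) i o') (pre_evolve (Rep_transducer \<tau>) i o')" for i o'
    proof (cases "pmf (out \<sigma>) o' > 0")
      case True
      have "?E (evolve \<sigma> (i, o')) (evolve \<tau> (i, o'))"
      proof (intro allI impI)
        fix h assume "possible (evolve \<sigma> (i, o')) h" "possible (evolve \<tau> (i, o')) h"
        then show "out (evolves (evolve \<sigma> (i, o')) h) = out (evolves (evolve \<tau> (i, o')) h)"
          using Eq_pretransducer[rule_format, of "(i, o') # h"] True out
          by (simp add: possible_Cons evolves_def)
      qed
      moreover have "pmf (out \<tau>) o' > 0"
        using True out by simp
      ultimately show ?thesis
        using True by (auto simp: pre_evolve_Rep)
    next
      case False
      then have "pmf (out \<sigma>) o' = 0" "pmf (out \<tau>) o' = 0"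
        using out by (simp_all add: pmf_pos order.order_iff_strict not_less)
      then show ?thesis
        by (simp add: pre_evolve_Rep_None)
    qed
    then show ?case
      using out by (auto simp: out_def rel_fun_def)
  qed
  then show "\<sigma> = \<tau>"
    by (simp add: Rep_transducer_inject)
qed simp

text \<open>\<open>True\<close> is the success signal \<open>\<top>\<close>, \<open>False\<close> is \<open>\<bottom>\<close>.\<close>

type_synonym ('s, 'a) policy = "('s, 'a) transducer"
type_synonym ('s, 'a) teleo_env = "('a, 's \<times> bool) transducer"

text \<open>
  One step of a coupling is a triple \<open>(a, (s, r))\<close>. A trajectory is a function
  \<open>\<omega> :: nat \<Rightarrow> 'a \<times> 's \<times> bool\<close>, with \<open>\<omega> t\<close> the step at time \<open>t + 1\<close>.
\<close>

fun policy_view :: "'a \<times> 's \<times> bool \<Rightarrow> 's \<times> 'a" where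
  "policy_view (a, s, r) = (s, a)"

definition next_step ::
    "('s, 'a) policy \<Rightarrow> ('s, 'a) teleo_env \<Rightarrow> ('a \<times> 's \<times> bool) list \<Rightarrow> ('a \<times> 's \<times> bool) pmf" where
  "next_step \<pi> \<epsilon> h = pair_pmf (out (evolves \<pi> (map policy_view h))) (out (evolves \<epsilon> h))"

definition step_kernel ::
    "('s, 'a) policy \<Rightarrow> ('s, 'a) teleo_env \<Rightarrow> nat \<Rightarrow> (nat \<Rightarrow> 'a \<times> 's \<times> bool)
      \<Rightarrow> ('a \<times> 's \<times> bool) measure" where
  "step_kernel \<pi> \<epsilon> t \<omega> = measure_pmf (next_step \<pi> \<epsilon> (map \<omega> [0..<t]))"

interpretation coupling: Ionescu_Tulcea "step_kernel \<pi> \<epsilon>" "\<lambda>_. count_space UNIV"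
  for \<pi> :: "('s::finite, 'a::finite) policy" and \<epsilon> :: "('s, 'a) teleo_env"
proof (rule Ionescu_Tulcea.intro)
  fix t :: nat
  have "PiM {0..<t} (\<lambda>_. count_space UNIV :: ('a \<times> 's \<times> bool) measure)
      = count_space ({0..<t} \<rightarrow>\<^sub>E UNIV)"
    by (rule count_space_PiM_finite) auto
  then show "step_kernel \<pi> \<epsilon> t \<in> PiM {0..<t} (\<lambda>_. count_space UNIV)
      \<rightarrow>\<^sub>M subprob_algebra (count_space UNIV)"
    by (simp add: step_kernel_def measure_pmf_in_subprob_algebra)
  show "prob_space (step_kernel \<pi> \<epsilon> t \<omega>)" for \<omega>
    unfolding step_kernel_def by (rule prob_space_measure_pmf)
qed

text \<open>The law of the trajectory, on the product space over all times, with kernels \<open>step_kernel\<close>.\<close>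

definition trajectory ::
    "('s::finite, 'a::finite) policy \<Rightarrow> ('s, 'a) teleo_env \<Rightarrow> (nat \<Rightarrow> 'a \<times> 's \<times> bool) measure" where
  "trajectory \<pi> \<epsilon> = coupling.PF.lim \<pi> \<epsilon>"

lemma space_trajectory: "space (trajectory \<pi> \<epsilon>) = UNIV"
  by (simp add: trajectory_def space_PiM)

lemma sets_trajectory: "sets (trajectory \<pi> \<epsilon>) = sets (PiM UNIV (\<lambda>_. count_space UNIV))"
  by (simp add: trajectory_def)

lemma sets_success:
  fixes \<pi> :: "('s::finite, 'a::finite) policy" and \<epsilon> :: "('s, 'a) teleo_env"
  shows "{\<omega>. \<exists>t. snd (snd (\<omega> t))} \<in> sets (trajectory \<pi> \<epsilon>)"
proof -
  have "{\<omega> \<in> space (PiM UNIV (\<lambda>_. count_space UNIV)). \<exists>t. snd (snd (\<omega> t))}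
      \<in> sets (PiM UNIV (\<lambda>_::nat. count_space UNIV :: ('a \<times> 's \<times> bool) measure))"
  proof (rule sets.sets_Collect_countable_Ex)
    fix t
    have "(\<lambda>\<omega>. \<omega> t) \<in> PiM UNIV (\<lambda>_::nat. count_space UNIV :: ('a \<times> 's \<times> bool) measure)
        \<rightarrow>\<^sub>M count_space UNIV"
      by (rule measurable_component_singleton) simp
    from measurable_compose[OF this measurable_count_space[where f="\<lambda>x. snd (snd x)"]]
    show "{\<omega> \<in> space (PiM UNIV (\<lambda>_. count_space UNIV)). snd (snd (\<omega> t))}
      \<in> sets (PiM UNIV (\<lambda>_::nat. count_space UNIV :: ('a \<times> 's \<times> bool) measure))"
      by (simp add: pred_def)
  qed
  then show ?thesis
    by (simp add: sets_trajectory space_PiM)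
qed

lemma emeasure_trajectory_cylinder:
  fixes \<pi> :: "('s::finite, 'a::finite) policy" and \<epsilon> :: "('s, 'a) teleo_env"
  shows "emeasure (trajectory \<pi> \<epsilon>) {\<omega>. \<forall>t < n. \<omega> t = w t}
    = (\<Prod>t<n. ennreal (pmf (next_step \<pi> \<epsilon> (map w [0..<t])) (w t)))"
proof -
  let ?M = "\<lambda>_::nat. count_space UNIV :: ('a \<times> 's \<times> bool) measure"
  have PiM: "PiM {0..<n} ?M = count_space ({0..<n} \<rightarrow>\<^sub>E UNIV)" for n
    by (rule count_space_PiM_finite) auto
  have r: "restrict w {0..<n} \<in> space (PiM {0..<n} ?M)" for n
    by (simp add: space_PiM)
  have sets_sing: "{restrict w {0..<n}} \<in> sets (PiM {0..<n} ?M)" for n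
    by (auto simp: PiM)
  have C: "emeasure (coupling.C \<pi> \<epsilon> 0 n (\<lambda>_. undefined)) {restrict w {0..<n}}
      = (\<Prod>t<n. ennreal (pmf (next_step \<pi> \<epsilon> (map w [0..<t])) (w t)))" for n
  proof (induction n)
    case 0
    then show ?case by (simp add: PiM_empty restrict_def fun_eq_iff)
  next
    case (Suc n)
    let ?C = "coupling.C \<pi> \<epsilon> 0 n (\<lambda>_. undefined)"
    let ?p = "ennreal (pmf (next_step \<pi> \<epsilon> (map w [0..<n])) (w n))"
    have sp: "space ?C = {0..<n} \<rightarrow>\<^sub>E UNIV"
      by (subst coupling.space_C) (auto simp: space_PiM)
    have sC: "sets ?C = sets (PiM {0..<n} ?M)"
      by (subst coupling.sets_C) (auto simp: space_PiM)
    have "emeasure (coupling.C \<pi> \<epsilon> 0 (Suc n) (\<lambda>_. undefined)) {restrict w {0..<Suc n}}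
        = (\<integral>\<^sup>+ x. emeasure (coupling.eP \<pi> \<epsilon> n x) {restrict w {0..<Suc n}} \<partial>?C)"
      unfolding coupling.C.simps add_0
    proof (rule emeasure_bind)
      show "space ?C \<noteq> {}" by (simp add: sp PiE_eq_empty_iff)
      show "coupling.eP \<pi> \<epsilon> n \<in> ?C \<rightarrow>\<^sub>M subprob_algebra (PiM {0..<Suc n} ?M)"
        using coupling.measurable_eP[of \<pi> \<epsilon> n] by (simp add: measurable_cong_sets[OF sC refl])
    qed (rule sets_sing)
    also have "\<dots> = (\<integral>\<^sup>+ x. ?p * indicator {restrict w {0..<n}} x \<partial>?C)"
    proof (rule nn_integral_cong)
      fix x assume "x \<in> space ?C"
      then have x: "x \<in> space (PiM {0..<n} ?M)" "x \<in> extensional {0..<n}"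
        by (auto simp: sp space_PiM PiE_iff)
      have upd: "x(n := a) = restrict w {0..<Suc n} \<longleftrightarrow> x = restrict w {0..<n} \<and> a = w n" for a
        using x(2) by (auto simp: fun_eq_iff extensional_def less_Suc_eq)
      have "emeasure (coupling.eP \<pi> \<epsilon> n x) {restrict w {0..<Suc n}}
          = emeasure (step_kernel \<pi> \<epsilon> n x) {a. x = restrict w {0..<n} \<and> a = w n}"
        by (subst coupling.emeasure_eP[OF x(1) sets_sing]) (simp add: vimage_def upd)
      also have "\<dots> = ?p * indicator {restrict w {0..<n}} x"
      proof (cases "x = restrict w {0..<n}")
        case True
        then have "map x [0..<n] = map w [0..<n]" by simp
        then have "step_kernel \<pi> \<epsilon> n x = measure_pmf (next_step \<pi> \<epsilon> (map w [0..<n]))"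
          by (simp only: step_kernel_def)
        with True show ?thesis by (simp add: emeasure_pmf_single)
      qed simp
      finally show "emeasure (coupling.eP \<pi> \<epsilon> n x) {restrict w {0..<Suc n}}
          = ?p * indicator {restrict w {0..<n}} x" .
    qed
    also have "\<dots> = ?p * emeasure ?C {restrict w {0..<n}}"
      using sets_sing sC by (intro nn_integral_cmult_indicator) auto
    finally show ?case
      by (simp only: Suc.IH prod.lessThan_Suc mult.commute)
  qed
  have "{\<omega>. \<forall>t < n. \<omega> t = w t} = prod_emb UNIV ?M {0..<n} {restrict w {0..<n}}"
    by (auto simp: prod_emb_def space_PiM fun_eq_iff restrict_def) metis
  then have "emeasure (trajectory \<pi> \<epsilon>) {\<omega>. \<forall>t < n. \<omega> t = w t}
      = emeasure (coupling.CI \<pi> \<epsilon> {0..<n}) {restrict w {0..<n}}"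
    using coupling.lim[OF _ sets_sing] by (simp add: trajectory_def)
  also have "\<dots> = emeasure (coupling.C \<pi> \<epsilon> 0 n (\<lambda>_. undefined)) {restrict w {0..<n}}"
    by (subst coupling.emeasure_CI[OF order.refl sets_sing])
       (rule arg_cong[where f="emeasure _"], auto simp: prod_emb_def space_PiM)
  finally show ?thesis
    by (simp add: C)
qed

definition V :: "('s::finite, 'a::finite) policy \<Rightarrow> ('s, 'a) teleo_env \<Rightarrow> real" where
  "V \<pi> \<epsilon> = measure (trajectory \<pi> \<epsilon>) {\<omega>. \<exists>t. snd (snd (\<omega> t))}"

definition optimal :: "('s::finite, 'a::finite) policy \<Rightarrow> ('s, 'a) teleo_env \<Rightarrow> bool" where
  "optimal \<pi> \<epsilon> \<longleftrightarrow> (\<forall>\<pi>'. V \<pi> \<epsilon> \<ge> V \<pi>' \<epsilon>)"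

definition uniquely_optimal :: "('s::finite, 'a::finite) policy \<Rightarrow> ('s, 'a) teleo_env \<Rightarrow> bool" where
  "uniquely_optimal \<pi> \<epsilon> \<longleftrightarrow> optimal \<pi> \<epsilon> \<and> (\<forall>\<pi>'. optimal \<pi>' \<epsilon> \<longrightarrow> \<pi>' = \<pi>)"

definition specifiable :: "('s::finite, 'a::finite) policy \<Rightarrow> bool" where
  "specifiable \<pi> \<longleftrightarrow> (\<exists>\<epsilon>. uniquely_optimal \<pi> \<epsilon>)"

end

theory Submission
  imports Defs
begin

text \<open>
  \<^bold>\<open>Deterministic policies are specifiable.\<close> The teleo-environment for a deterministic policy
  \<open>\<pi>\<close> simulates \<open>\<pi>\<close> and compares. As long as every received action is the one that \<open>\<pi>\<close>
  would have produced, it emits a uniformly random sensor value and an independent fair coin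
  as success signal; after the first deviation it never signals success again. Against \<open>\<pi>\<close> the
  coin is tossed forever, so success is almost sure (\<open>fail_prob_examiner_self\<close>). Any other
  policy puts positive probability on a wrong action at some history that both policies admit.
  All sensor values have positive probability and every coin may have failed so far, so with
  positive probability the deviation happens before any success, and success never comes
  (\<open>fail_prob_examiner_deviant\<close>).

  \<^bold>\<open>Specifiable policies are deterministic.\<close> A run passes through a given history at most once,
  so randomizing the action at that history is the same as drawing the action in advance: the
  success probability is affine in the action distribution there. If \<open>b\<close> ranges over the
  actions and \<open>commit h b \<pi>\<close> plays \<open>b\<close> for sure at \<open>h\<close>, then \<open>V \<pi> \<epsilon>\<close> is the average of the
  values \<open>V (commit h b \<pi>) \<epsilon>\<close> (\<open>V_commit\<close>). If \<open>\<pi>\<close> is optimal, every \<open>b\<close> in the support attains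
  the same value, so unique optimality forces \<open>commit h b \<pi> = \<pi>\<close>, a point mass at \<open>h\<close>.

  Both arguments are carried out on \<open>fail_prob n \<pi> \<epsilon>\<close>, the probability that the first \<open>n\<close> steps
  bring no success. It satisfies a one-step recursion in which policy and environment simply
  evolve, so facts about it are inductions on the horizon or on a history; measure theory
  enters only in \<open>fail_prob_tendsto\<close>, where it is linked to \<open>V\<close>.
\<close>

section \<open>Building transducers\<close>

definition prepend :: "'o pmf \<Rightarrow> ('i \<times> 'o \<Rightarrow> ('i, 'o) transducer) \<Rightarrow> ('i, 'o) transducer" where
  "prepend p f = Abs_transducer (Pretransducer p
     (\<lambda>i o'. if pmf p o' > 0 then Some (Rep_transducer (f (i, o'))) else None))"

lemma Rep_prepend:
  "Rep_transducer (prepend p f) = Pretransducer p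
     (\<lambda>i o'. if pmf p o' > 0 then Some (Rep_transducer (f (i, o'))) else None)"
  unfolding prepend_def
proof (rule Abs_transducer_inverse, rule CollectI, rule wf_pretransducer.intros)
  fix i o' t'
  assume "pre_evolve (Pretransducer p (\<lambda>i o'. if pmf p o' > 0
      then Some (Rep_transducer (f (i, o'))) else None)) i o' = Some t'"
  then show "wf_pretransducer t'"
    using Rep_transducer by (auto split: if_splits)
qed simp

lemma out_prepend [simp]: "out (prepend p f) = p"
  by (simp add: out_def Rep_prepend)

lemma evolve_prepend [simp]: "pmf p (snd x) > 0 \<Longrightarrow> evolve (prepend p f) x = f x"
  by (cases x) (simp add: evolve_def Rep_prepend Rep_transducer_inverse)

primcorec pre_unfold ::
    "('q \<Rightarrow> 'o pmf) \<Rightarrow> ('q \<Rightarrow> 'i \<times> 'o \<Rightarrow> 'q) \<Rightarrow> 'q \<Rightarrow> ('i, 'o) pretransducer" where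
  "pre_unfold p d q = Pretransducer (p q)
     (\<lambda>i o'. if pmf (p q) o' > 0 then Some (pre_unfold p d (d q (i, o'))) else None)"

definition unfold_transducer ::
    "('q \<Rightarrow> 'o pmf) \<Rightarrow> ('q \<Rightarrow> 'i \<times> 'o \<Rightarrow> 'q) \<Rightarrow> 'q \<Rightarrow> ('i, 'o) transducer" where
  "unfold_transducer p d q = Abs_transducer (pre_unfold p d q)"

lemma wf_pre_unfold: "wf_pretransducer (pre_unfold p d q)"
proof (coinduction arbitrary: q rule: wf_pretransducer.coinduct)
  case wf_pretransducer
  then show ?case by (auto split: if_splits)
qed

lemma out_unfold_transducer: "out (unfold_transducer p d q) = p q"
  by (simp add: out_def unfold_transducer_def Abs_transducer_inverse wf_pre_unfold)

lemma evolve_unfold_transducer: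
  "pmf (p q) (snd x) > 0 \<Longrightarrow>
    evolve (unfold_transducer p d q) x = unfold_transducer p d (d q x)"
  by (cases x) (simp add: evolve_def unfold_transducer_def Abs_transducer_inverse wf_pre_unfold)

lemma evolves_Nil [simp]: "evolves \<tau> [] = \<tau>"
  by (simp add: evolves_def)

lemma evolves_Cons [simp]: "evolves \<tau> (x # h) = evolves (evolve \<tau> x) h"
  by (simp add: evolves_def)

section \<open>The probability of no success within a finite horizon\<close>

primrec fail_prob ::
    "nat \<Rightarrow> ('s::finite, 'a::finite) policy \<Rightarrow> ('s, 'a) teleo_env \<Rightarrow> real" where
  "fail_prob 0 \<pi> \<epsilon> = 1"
| "fail_prob (Suc n) \<pi> \<epsilon> = (\<Sum>a\<in>UNIV. \<Sum>s\<in>UNIV. pmf (out \<pi>) a * pmf (out \<epsilon>) (s, False) *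
     fail_prob n (evolve \<pi> (s, a)) (evolve \<epsilon> (a, s, False)))"

text \<open>
  \<open>fail_prob\<close> keeps only the outputs with signal \<open>False\<close>. The arbitrary value of \<open>evolve\<close> at
  outputs of probability zero is harmless, being multiplied by that probability.
\<close>

definition failures :: "nat \<Rightarrow> ('a \<times> 's \<times> bool) list set" where
  "failures n = {h. length h = n \<and> (\<forall>x \<in> set h. \<not> snd (snd x))}"

lemma failures_0: "failures 0 = {[]}"
  by (auto simp: failures_def)

lemma failures_Suc:
  "failures (Suc n) = (\<lambda>((a, s), h). (a, s, False) # h) ` (UNIV \<times> failures n)"
  by (auto simp: failures_def length_Suc_conv image_iff)

lemma finite_failures: "finite (failures n :: ('a::finite \<times> 's::finite \<times> bool) list set)"
  by (induction n) (simp_all add: failures_0 failures_Suc)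

definition path_prob ::
    "('s, 'a) policy \<Rightarrow> ('s, 'a) teleo_env \<Rightarrow> ('a \<times> 's \<times> bool) list \<Rightarrow> real" where
  "path_prob \<pi> \<epsilon> h = (\<Prod>t<length h. pmf (next_step \<pi> \<epsilon> (take t h)) (h ! t))"

lemma path_prob_Cons:
  "path_prob \<pi> \<epsilon> ((a, s, r) # h) =
     pmf (out \<pi>) a * pmf (out \<epsilon>) (s, r) * path_prob (evolve \<pi> (s, a)) (evolve \<epsilon> (a, s, r)) h"
  by (simp add: path_prob_def prod.lessThan_Suc_shift next_step_def pmf_pair del: prod.lessThan_Suc)

lemma sum_path_prob_failures:
  fixes \<pi> :: "('s::finite, 'a::finite) policy"
  shows "(\<Sum>h\<in>failures n. path_prob \<pi> \<epsilon> h) = fail_prob n \<pi> \<epsilon>"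
proof (induction n arbitrary: \<pi> \<epsilon>)
  case 0
  show ?case by (simp add: failures_0 path_prob_def)
next
  case (Suc n)
  have inj: "inj_on (\<lambda>((a, s), h). (a, s, False) # h) (UNIV \<times> failures n)"
    by (auto simp: inj_on_def)
  have "(\<Sum>h\<in>failures (Suc n). path_prob \<pi> \<epsilon> h)
      = (\<Sum>((a, s), h)\<in>UNIV \<times> failures n. path_prob \<pi> \<epsilon> ((a, s, False) # h))"
    unfolding failures_Suc by (subst sum.reindex[OF inj]) (simp add: case_prod_unfold)
  also have "\<dots> = (\<Sum>(a, s)\<in>UNIV. \<Sum>h\<in>failures n. path_prob \<pi> \<epsilon> ((a, s, False) # h))"
    by (subst sum.cartesian_product[symmetric]) (simp add: case_prod_unfold)
  also have "\<dots> = (\<Sum>(a, s)\<in>UNIV \<times> UNIV. pmf (out \<pi>) a * pmf (out \<epsilon>) (s, False) *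
      fail_prob n (evolve \<pi> (s, a)) (evolve \<epsilon> (a, s, False)))"
    by (simp add: path_prob_Cons sum_distrib_left[symmetric] Suc.IH)
  also have "\<dots> = fail_prob (Suc n) \<pi> \<epsilon>"
    by (simp only: sum.cartesian_product[symmetric] fail_prob.simps)
  finally show ?case .
qed

lemma prob_space_trajectory: "prob_space (trajectory \<pi> \<epsilon>)"
  using emeasure_trajectory_cylinder[of \<pi> \<epsilon> 0]
  by (intro prob_spaceI) (simp add: space_trajectory)

lemma sets_trajectory_step:
  fixes \<pi> :: "('s::finite, 'a::finite) policy"
  shows "{\<omega>. P (\<omega> t)} \<in> sets (trajectory \<pi> \<epsilon>)"
proof -
  have "(\<lambda>\<omega>. \<omega> t) \<in> PiM UNIV (\<lambda>_::nat. count_space UNIV :: ('a \<times> 's \<times> bool) measure)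
      \<rightarrow>\<^sub>M count_space UNIV"
    by (rule measurable_component_singleton) simp
  from measurable_sets[OF this, of "Collect P"] show ?thesis
    by (simp add: sets_trajectory space_PiM vimage_def)
qed

lemma sets_trajectory_prefix:
  fixes \<pi> :: "('s::finite, 'a::finite) policy"
  shows "{\<omega>. \<forall>t < n. P t (\<omega> t)} \<in> sets (trajectory \<pi> \<epsilon>)"
proof -
  have "{\<omega> \<in> space (trajectory \<pi> \<epsilon>). \<forall>t. t < n \<longrightarrow> P t (\<omega> t)} \<in> sets (trajectory \<pi> \<epsilon>)"
  proof (rule sets.sets_Collect_countable_All)
    show "{\<omega> \<in> space (trajectory \<pi> \<epsilon>). t < n \<longrightarrow> P t (\<omega> t)} \<in> sets (trajectory \<pi> \<epsilon>)" for t
      using sets_trajectory_step[of "\<lambda>x. t < n \<longrightarrow> P t x" t] by (simp add: space_trajectory)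
  qed
  then show ?thesis by (simp add: space_trajectory)
qed

lemma measure_trajectory_path:
  fixes \<pi> :: "('s::finite, 'a::finite) policy"
  assumes "length h = n"
  shows "measure (trajectory \<pi> \<epsilon>) {\<omega>. \<forall>t < n. \<omega> t = h ! t} = path_prob \<pi> \<epsilon> h"
proof -
  have "map ((!) h) [0..<t] = take t h" if "t < n" for t
    using that assms by (simp add: list_eq_iff_nth_eq)
  then show ?thesis
    using assms
    by (simp add: measure_def emeasure_trajectory_cylinder prod_ennreal path_prob_def prod_nonneg)
qed

text \<open>
  The event splits into the finitely many cylinders over success-free histories.
\<close>

lemma measure_trajectory_failures:
  fixes \<pi> :: "('s::finite, 'a::finite) policy"
  shows "measure (trajectory \<pi> \<epsilon>) {\<omega>. \<forall>t < n. \<not> snd (snd (\<omega> t))} = fail_prob n \<pi> \<epsilon>"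
proof -
  interpret prob_space "trajectory \<pi> \<epsilon>" by (rule prob_space_trajectory)
  let ?C = "\<lambda>h :: ('a \<times> 's \<times> bool) list. {\<omega>. \<forall>t < n. \<omega> t = h ! t}"
  have "{\<omega>. \<forall>t < n. \<not> snd (snd (\<omega> t))} = (\<Union>h\<in>failures n. ?C h)"
  proof (intro equalityI subsetI)
    fix \<omega> :: "nat \<Rightarrow> 'a \<times> 's \<times> bool" assume "\<omega> \<in> {\<omega>. \<forall>t < n. \<not> snd (snd (\<omega> t))}"
    then have "map \<omega> [0..<n] \<in> failures n" by (auto simp: failures_def)
    then show "\<omega> \<in> (\<Union>h\<in>failures n. ?C h)" by (rule UN_I) simp
  next
    fix \<omega> assume "\<omega> \<in> (\<Union>h\<in>failures n. ?C h)"
    then show "\<omega> \<in> {\<omega>. \<forall>t < n. \<not> snd (snd (\<omega> t))}" by (auto simp: failures_def)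
  qed
  moreover have "disjoint_family_on ?C (failures n)"
    by (auto simp: disjoint_family_on_def failures_def list_eq_iff_nth_eq)
  moreover have "?C ` failures n \<subseteq> events"
    using sets_trajectory_prefix[of n "\<lambda>t x. x = _ ! t"] by blast
  ultimately have "prob {\<omega>. \<forall>t < n. \<not> snd (snd (\<omega> t))} = (\<Sum>h\<in>failures n. prob (?C h))"
    by (simp add: finite_measure_finite_Union finite_failures)
  also have "\<dots> = (\<Sum>h\<in>failures n. path_prob \<pi> \<epsilon> h)"
    by (intro sum.cong refl measure_trajectory_path) (simp add: failures_def)
  finally show ?thesis by (simp add: sum_path_prob_failures)
qed

text \<open>
  Continuity from above: the events of no success up to time \<open>n\<close> decrease to the complement
  of the event measured by \<open>V\<close>.
\<close>

lemma fail_prob_tendsto: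
  fixes \<pi> :: "('s::finite, 'a::finite) policy"
  shows "(\<lambda>n. fail_prob n \<pi> \<epsilon>) \<longlonglongrightarrow> 1 - V \<pi> \<epsilon>"
proof -
  interpret prob_space "trajectory \<pi> \<epsilon>" by (rule prob_space_trajectory)
  let ?A = "\<lambda>n. {\<omega> :: nat \<Rightarrow> 'a \<times> 's \<times> bool. \<forall>t < n. \<not> snd (snd (\<omega> t))}"
  have "(\<lambda>n. prob (?A n)) \<longlonglongrightarrow> prob (\<Inter>n. ?A n)"
  proof (rule finite_Lim_measure_decseq)
    show "range ?A \<subseteq> events"
      using sets_trajectory_prefix[of _ "\<lambda>_ x. \<not> snd (snd x)"] by blast
  qed (auto simp: decseq_def)
  moreover have "(\<Inter>n. ?A n) = space (trajectory \<pi> \<epsilon>) - {\<omega>. \<exists>t. snd (snd (\<omega> t))}"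
    by (auto simp: space_trajectory)
  ultimately show ?thesis
    by (simp add: measure_trajectory_failures prob_compl sets_success V_def)
qed

lemma fail_prob_nonneg: "fail_prob n \<pi> \<epsilon> \<ge> 0"
  by (induction n arbitrary: \<pi> \<epsilon>) (simp_all add: sum_nonneg)

lemma V_le_1: "V \<pi> \<epsilon> \<le> 1"
  unfolding V_def by (rule prob_space.prob_le_1[OF prob_space_trajectory])

section \<open>Deterministic policies are specifiable\<close>

text \<open>
  The state \<open>Some \<pi>\<close> records that the actions so far conform to the simulated policy, which has
  now evolved to \<open>\<pi>\<close>; the state \<open>None\<close> records a deviation. Conformity is tested by positive
  probability, which for a deterministic \<open>\<pi>\<close> is equality with its action. The uniform
  distribution on \<open>UNIV :: ('s \<times> bool) set\<close> is a uniform sensor value with an independent coin.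
\<close>

fun examiner_out :: "('s::finite, 'a) policy option \<Rightarrow> ('s \<times> bool) pmf" where
  "examiner_out (Some \<pi>) = pmf_of_set UNIV"
| "examiner_out None = return_pmf (undefined, False)"

fun examiner_next :: "('s, 'a) policy option \<Rightarrow> 'a \<times> 's \<times> bool \<Rightarrow> ('s, 'a) policy option" where
  "examiner_next (Some \<pi>) (a, s, r) = (if pmf (out \<pi>) a > 0 then Some (evolve \<pi> (s, a)) else None)"
| "examiner_next None x = None"

definition examiner :: "('s::finite, 'a) policy option \<Rightarrow> ('s, 'a) teleo_env" where
  "examiner = unfold_transducer examiner_out examiner_next"

lemma out_examiner [simp]: "out (examiner q) = examiner_out q"
  by (simp add: examiner_def out_unfold_transducer)

lemma evolve_examiner:
  "pmf (examiner_out q) (snd x) > 0 \<Longrightarrow> evolve (examiner q) x = examiner (examiner_next q x)"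
  by (simp add: examiner_def evolve_unfold_transducer)

lemma pmf_examiner_out_Some:
  "pmf (examiner_out (Some \<pi>)) (s :: 's::finite, r) = 1 / (2 * CARD('s))"
  by (simp add: UNIV_Times_UNIV[symmetric] card_cartesian_product del: UNIV_Times_UNIV)

lemma evolve_examiner_Some:
  fixes s :: "'s::finite"
  shows "evolve (examiner (Some \<pi>)) (a, s, r) = examiner (examiner_next (Some \<pi>) (a, s, r))"
  by (rule evolve_examiner) (simp only: snd_conv pmf_examiner_out_Some, simp)

lemma fail_prob_examiner_None:
  fixes \<pi> :: "('s::finite, 'a::finite) policy"
  shows "fail_prob n \<pi> (examiner None) = 1"
proof (induction n arbitrary: \<pi>)
  case (Suc n)
  have "fail_prob (Suc n) \<pi> (examiner None)
      = (\<Sum>a\<in>UNIV. \<Sum>s\<in>(UNIV :: 's set). pmf (out \<pi>) a * indicator {undefined} s)"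
    unfolding fail_prob.simps
  proof (intro sum.cong refl)
    fix a and s :: 's
    show "pmf (out \<pi>) a * pmf (out (examiner None)) (s, False) *
        fail_prob n (evolve \<pi> (s, a)) (evolve (examiner None) (a, s, False))
      = pmf (out \<pi>) a * indicator {undefined} s"
      by (cases "s = undefined") (simp_all add: evolve_examiner Suc.IH)
  qed
  also have "\<dots> = 1"
    by (simp add: sum_distrib_left[symmetric] sum_pmf_eq_1 indicator_def)
  finally show ?case .
qed simp

lemma deterministic_evolve:
  "deterministic \<pi> \<Longrightarrow> pmf (out \<pi>) a > 0 \<Longrightarrow> deterministic (evolve \<pi> (s, a))"
  unfolding deterministic_def by (metis evolves_Cons possible_Cons snd_conv)

text \<open>
  A deterministic policy never deviates from itself, so each step is one more fair coin.
\<close>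

lemma fail_prob_examiner_self:
  fixes \<pi> :: "('s::finite, 'a::finite) policy"
  assumes "deterministic \<pi>"
  shows "fail_prob n \<pi> (examiner (Some \<pi>)) = (1/2) ^ n"
  using assms
proof (induction n arbitrary: \<pi>)
  case (Suc n)
  have "fail_prob (Suc n) \<pi> (examiner (Some \<pi>))
      = (\<Sum>a\<in>UNIV. \<Sum>s\<in>(UNIV :: 's set). pmf (out \<pi>) a * ((1/2) ^ n / (2 * CARD('s))))"
    unfolding fail_prob.simps
  proof (intro sum.cong refl)
    fix a and s :: 's
    show "pmf (out \<pi>) a * pmf (out (examiner (Some \<pi>))) (s, False) *
        fail_prob n (evolve \<pi> (s, a)) (evolve (examiner (Some \<pi>)) (a, s, False))
      = pmf (out \<pi>) a * ((1/2) ^ n / (2 * CARD('s)))"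
      using Suc.IH[OF deterministic_evolve[OF Suc.prems]]
      by (cases "pmf (out \<pi>) a > 0")
        (simp_all add: out_examiner evolve_examiner_Some pmf_examiner_out_Some pmf_pos
          del: examiner_out.simps, simp add: not_less)
  qed
  also have "\<dots> = (\<Sum>a\<in>UNIV. pmf (out \<pi>) a) * (1/2) ^ Suc n"
    by (simp add: sum_distrib_right)
  also have "\<dots> = (1/2) ^ Suc n" by (simp add: sum_pmf_eq_1)
  finally show ?case .
qed simp

lemma fail_prob_ge_term:
  fixes \<pi> :: "('s::finite, 'a::finite) policy"
  shows "fail_prob (Suc n) \<pi> \<epsilon> \<ge> pmf (out \<pi>) a * pmf (out \<epsilon>) (s, False) *
     fail_prob n (evolve \<pi> (s, a)) (evolve \<epsilon> (a, s, False))"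
proof -
  let ?f = "\<lambda>a s. pmf (out \<pi>) a * pmf (out \<epsilon>) (s, False) *
     fail_prob n (evolve \<pi> (s, a)) (evolve \<epsilon> (a, s, False))"
  have "?f a s \<le> (\<Sum>s\<in>UNIV. ?f a s)"
    by (rule member_le_sum) (simp_all add: fail_prob_nonneg)
  also have "\<dots> \<le> (\<Sum>a\<in>UNIV. \<Sum>s\<in>UNIV. ?f a s)"
    by (rule member_le_sum[of a UNIV "\<lambda>a. \<Sum>s\<in>UNIV. ?f a s"])
      (simp_all add: fail_prob_nonneg sum_nonneg)
  finally show ?thesis by simp
qed

text \<open>
  A positive lower bound that is uniform in the horizon survives in the limit. It propagates
  backwards along a history, shrinking at each step by the probability of that step.
\<close>

lemma fail_prob_bounded_step:
  fixes \<pi> :: "('s::finite, 'a::finite) policy"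
  assumes c: "c > 0" "\<And>n. fail_prob n (evolve \<pi> (s, a)) (evolve \<epsilon> (a, s, False)) \<ge> c"
    and pos: "pmf (out \<pi>) a > 0" "pmf (out \<epsilon>) (s, False) > 0"
  shows "\<exists>c > 0. \<forall>n. fail_prob n \<pi> \<epsilon> \<ge> c"
proof (intro exI conjI allI)
  let ?k = "pmf (out \<pi>) a * pmf (out \<epsilon>) (s, False)"
  \<comment> \<open>the minimum covers the horizon \<open>0\<close>, where the probability is \<open>1\<close>\<close>
  show "min 1 (?k * c) > 0" using c(1) pos by simp
  fix n
  show "fail_prob n \<pi> \<epsilon> \<ge> min 1 (?k * c)"
  proof (cases n)
    case (Suc m)
    have "?k * c \<le> ?k * fail_prob m (evolve \<pi> (s, a)) (evolve \<epsilon> (a, s, False))"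
      using c(2) by (intro mult_left_mono) simp_all
    also have "\<dots> \<le> fail_prob (Suc m) \<pi> \<epsilon>" by (rule fail_prob_ge_term)
    finally show ?thesis by (simp add: Suc)
  qed simp
qed

text \<open>
  By induction along the history leading to the disagreement: before its end both policies
  give positive probability to the actions taken, so the examiner keeps following \<open>\<pi>\<close>; at its
  end \<open>\<pi>'\<close> can play an action that \<open>\<pi>\<close> never plays, after which no success comes. All this
  happens with positive probability while every coin shows failure.
\<close>

lemma fail_prob_examiner_deviant:
  fixes \<pi> \<pi>' :: "('s::finite, 'a::finite) policy"
  assumes "deterministic \<pi>" "possible \<pi> h" "possible \<pi>' h"
    and "out (evolves \<pi>' h) \<noteq> out (evolves \<pi> h)"
  shows "\<exists>c > 0. \<forall>n. fail_prob n \<pi>' (examiner (Some \<pi>)) \<ge> c"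
  using assms
proof (induction h arbitrary: \<pi> \<pi>')
  case Nil
  obtain a where a: "out \<pi> = return_pmf a"
    using Nil.prems(1) possible_Nil by (metis deterministic_def evolves_Nil)
  with Nil.prems(4) have "\<not> set_pmf (out \<pi>') \<subseteq> {a}"
    by (simp add: set_pmf_subset_singleton)
  then obtain b where b: "b \<in> set_pmf (out \<pi>')" "b \<noteq> a" by blast
  show ?case
  proof (rule fail_prob_bounded_step)
    \<comment> \<open>any sensor value will do, since all have positive probability\<close>
    show "fail_prob n (evolve \<pi>' (undefined, b))
        (evolve (examiner (Some \<pi>)) (b, undefined, False)) \<ge> 1" for n
      using a b by (simp add: evolve_examiner_Some fail_prob_examiner_None)
    show "pmf (out \<pi>') b > 0" using b by (simp add: pmf_positive)
  qed (simp_all only: out_examiner pmf_examiner_out_Some, simp_all)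
next
  case (Cons x h)
  obtain s a where x: "x = (s, a)" by (cases x)
  have pos: "pmf (out \<pi>) a > 0" "pmf (out \<pi>') a > 0"
    using Cons.prems by (simp_all add: possible_Cons x)
  obtain c where c: "c > 0"
      "\<And>n. fail_prob n (evolve \<pi>' (s, a)) (examiner (Some (evolve \<pi> (s, a)))) \<ge> c"
    using Cons.IH[of "evolve \<pi> (s, a)" "evolve \<pi>' (s, a)"] Cons.prems
      deterministic_evolve[OF Cons.prems(1) pos(1)]
    by (auto simp: possible_Cons x)
  show ?case
  proof (rule fail_prob_bounded_step[OF c(1)])
    show "fail_prob n (evolve \<pi>' (s, a)) (evolve (examiner (Some \<pi>)) (a, s, False)) \<ge> c" for n
      using c(2) pos by (simp add: evolve_examiner_Some)
    show "pmf (out (examiner (Some \<pi>))) (s, False) > 0"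
      by (simp only: out_examiner pmf_examiner_out_Some) simp
  qed (rule pos)
qed

lemma deterministic_imp_specifiable:
  fixes \<pi> :: "('s::finite, 'a::finite) policy"
  assumes "deterministic \<pi>"
  shows "specifiable \<pi>"
proof -
  let ?\<epsilon> = "examiner (Some \<pi>)"
  have "(\<lambda>n. (1/2) ^ n) \<longlonglongrightarrow> 1 - V \<pi> ?\<epsilon>"
    using fail_prob_tendsto[of \<pi> ?\<epsilon>] by (simp add: fail_prob_examiner_self assms)
  moreover have "(\<lambda>n. (1/2 :: real) ^ n) \<longlonglongrightarrow> 0" by (rule LIMSEQ_power_zero) simp
  ultimately have V1: "V \<pi> ?\<epsilon> = 1" using LIMSEQ_unique by fastforce
  have "\<pi>' = \<pi>" if opt: "optimal \<pi>' ?\<epsilon>" for \<pi>'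
  proof (rule ccontr)
    assume "\<pi>' \<noteq> \<pi>"
    then obtain h where "possible \<pi>' h" "possible \<pi> h" "out (evolves \<pi>' h) \<noteq> out (evolves \<pi> h)"
      by (auto simp: transducer_eq_iff[of \<pi>' \<pi>])
    then obtain c where c: "c > 0" "\<And>n. fail_prob n \<pi>' ?\<epsilon> \<ge> c"
      using fail_prob_examiner_deviant[OF assms] by blast
    have "c \<le> 1 - V \<pi>' ?\<epsilon>"
      by (rule LIMSEQ_le_const[OF fail_prob_tendsto]) (use c in auto)
    with c(1) V1 opt[unfolded optimal_def, rule_format, of \<pi>] show False by simp
  qed
  then show ?thesis
    unfolding specifiable_def uniquely_optimal_def optimal_def using V1 V_le_1 by metis
qed

section \<open>Specifiable policies are deterministic\<close>

text \<open>
  Off the history \<open>h\<close> the policy is left unchanged. If \<open>a\<close> has probability zero at \<open>h\<close>, what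
  follows it is unspecified, but such an \<open>a\<close> gets weight zero below.
\<close>

primrec commit :: "('i \<times> 'o) list \<Rightarrow> 'o \<Rightarrow> ('i, 'o) transducer \<Rightarrow> ('i, 'o) transducer" where
  "commit [] a \<pi> = prepend (return_pmf a) (evolve \<pi>)"
| "commit (x # h) a \<pi> =
     prepend (out \<pi>) (\<lambda>y. if y = x then commit h a (evolve \<pi> x) else evolve \<pi> y)"

lemma out_evolves_commit:
  "possible \<pi> h \<Longrightarrow> out (evolves (commit h a \<pi>) h) = return_pmf a"
  by (induction h arbitrary: \<pi>) (simp_all add: possible_Cons)

text \<open>
  Induction along \<open>h\<close>: a step that leaves \<open>h\<close> leads all the committed policies to the same
  state as \<open>\<pi>\<close>, so averaging over \<open>b\<close> changes nothing; the step that follows \<open>h\<close> is the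
  induction hypothesis.
\<close>

lemma fail_prob_commit:
  fixes \<pi> :: "('s::finite, 'a::finite) policy"
  assumes "possible \<pi> h"
  shows "fail_prob n \<pi> \<epsilon>
    = (\<Sum>b\<in>UNIV. pmf (out (evolves \<pi> h)) b * fail_prob n (commit h b \<pi>) \<epsilon>)"
  using assms
proof (induction h arbitrary: n \<pi> \<epsilon>)
  case Nil
  show ?case
  proof (cases n)
    case (Suc m)
    let ?g = "\<lambda>a s. pmf (out \<epsilon>) (s, False) *
       fail_prob m (evolve \<pi> (s, a)) (evolve \<epsilon> (a, s, False))"
    have "fail_prob (Suc m) (commit [] b \<pi>) \<epsilon> = (\<Sum>s\<in>UNIV. ?g b s)" for b
    proof -
      have "fail_prob (Suc m) (commit [] b \<pi>) \<epsilon>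
          = (\<Sum>a\<in>UNIV. if a = b then \<Sum>s\<in>UNIV. ?g b s else 0)"
        unfolding fail_prob.simps by (intro sum.cong refl) simp
      then show ?thesis by simp
    qed
    then show ?thesis
      by (simp add: Suc sum_distrib_left mult.assoc del: commit.simps)
  qed (simp add: sum_pmf_eq_1)
next
  case (Cons x h)
  let ?q = "pmf (out (evolves (evolve \<pi> x) h))"
  have x: "pmf (out \<pi>) (snd x) > 0" "possible (evolve \<pi> x) h"
    using Cons.prems by (simp_all add: possible_Cons)
  show ?case
  proof (cases n)
    case (Suc m)
    let ?w = "\<lambda>a s. pmf (out \<pi>) a * pmf (out \<epsilon>) (s, False)"
    let ?F = "\<lambda>b a s. fail_prob m (evolve (commit (x # h) b \<pi>) (s, a)) (evolve \<epsilon> (a, s, False))"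
    have mix: "?w a s * fail_prob m (evolve \<pi> (s, a)) (evolve \<epsilon> (a, s, False))
        = (\<Sum>b\<in>UNIV. ?q b * (?w a s * ?F b a s))" for a s
    proof (cases "pmf (out \<pi>) a > 0")
      case True
      have "fail_prob m (evolve \<pi> (s, a)) (evolve \<epsilon> (a, s, False)) = (\<Sum>b\<in>UNIV. ?q b * ?F b a s)"
      \<comment> \<open>whether this step follows or leaves the history\<close>
      proof (cases "x = (s, a)")
        case True
        with x Cons.IH[OF x(2)] show ?thesis by simp
      next
        case False
        with \<open>pmf (out \<pi>) a > 0\<close> show ?thesis
          by (simp add: sum_distrib_right[symmetric] sum_pmf_eq_1)
      qed
      then show ?thesis by (simp add: sum_distrib_left mult_ac)
    next
      case False
      then have "pmf (out \<pi>) a = 0" by (simp add: not_less)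
      then show ?thesis by simp
    qed
    have "fail_prob (Suc m) \<pi> \<epsilon> = (\<Sum>a\<in>UNIV. \<Sum>s\<in>UNIV. \<Sum>b\<in>UNIV. ?q b * (?w a s * ?F b a s))"
      by (simp only: fail_prob.simps mix)
    also have "\<dots> = (\<Sum>a\<in>UNIV. \<Sum>b\<in>UNIV. \<Sum>s\<in>UNIV. ?q b * (?w a s * ?F b a s))"
      by (intro sum.cong refl sum.swap)
    also have "\<dots> = (\<Sum>b\<in>UNIV. \<Sum>a\<in>UNIV. \<Sum>s\<in>UNIV. ?q b * (?w a s * ?F b a s))"
      by (rule sum.swap)
    also have "\<dots> = (\<Sum>b\<in>UNIV. ?q b * fail_prob (Suc m) (commit (x # h) b \<pi>) \<epsilon>)"
      by (simp add: sum_distrib_left)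
    finally show ?thesis by (simp add: Suc del: fail_prob.simps commit.simps)
  qed (simp add: sum_pmf_eq_1)
qed

lemma V_commit:
  fixes \<pi> :: "('s::finite, 'a::finite) policy"
  assumes "possible \<pi> h"
  shows "V \<pi> \<epsilon> = (\<Sum>b\<in>UNIV. pmf (out (evolves \<pi> h)) b * V (commit h b \<pi>) \<epsilon>)"
proof -
  let ?q = "pmf (out (evolves \<pi> h))"
  have "(\<lambda>n. fail_prob n \<pi> \<epsilon>) \<longlonglongrightarrow> (\<Sum>b\<in>UNIV. ?q b * (1 - V (commit h b \<pi>) \<epsilon>))"
    unfolding fail_prob_commit[OF assms] by (intro tendsto_intros fail_prob_tendsto)
  then have "1 - V \<pi> \<epsilon> = (\<Sum>b\<in>UNIV. ?q b * (1 - V (commit h b \<pi>) \<epsilon>))"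
    using fail_prob_tendsto LIMSEQ_unique by blast
  then show ?thesis
    by (simp add: algebra_simps sum_subtractf sum_pmf_eq_1)
qed

lemma specifiable_imp_deterministic:
  fixes \<pi> :: "('s::finite, 'a::finite) policy"
  assumes "specifiable \<pi>"
  shows "deterministic \<pi>"
  unfolding deterministic_def
proof (intro allI impI)
  fix h assume h: "possible \<pi> h"
  obtain \<epsilon> where opt: "\<And>\<pi>'. V \<pi>' \<epsilon> \<le> V \<pi> \<epsilon>" and uniq: "\<And>\<pi>'. optimal \<pi>' \<epsilon> \<Longrightarrow> \<pi>' = \<pi>"
    using assms unfolding specifiable_def uniquely_optimal_def optimal_def by blast
  let ?q = "pmf (out (evolves \<pi> h))"
  obtain a where a: "a \<in> set_pmf (out (evolves \<pi> h))"
    using set_pmf_not_empty by fast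
  \<comment> \<open>no term of the average exceeds it, so none of positive weight is below it\<close>
  have "V (commit h a \<pi>) \<epsilon> = V \<pi> \<epsilon>"
  proof (rule ccontr)
    assume "V (commit h a \<pi>) \<epsilon> \<noteq> V \<pi> \<epsilon>"
    then have "?q a * V (commit h a \<pi>) \<epsilon> < ?q a * V \<pi> \<epsilon>"
      using opt[of "commit h a \<pi>"] a by (simp add: pmf_positive)
    then have "(\<Sum>b\<in>UNIV. ?q b * V (commit h b \<pi>) \<epsilon>) < (\<Sum>b\<in>UNIV. ?q b * V \<pi> \<epsilon>)"
      by (intro sum_strict_mono_ex1) (auto intro: mult_left_mono opt)
    then show False
      by (simp add: V_commit[OF h, symmetric] sum_distrib_right[symmetric] sum_pmf_eq_1)
  qed
  then have "commit h a \<pi> = \<pi>"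
    using uniq opt by (simp add: optimal_def)
  with out_evolves_commit[OF h, of a] show "\<exists>a. out (evolves \<pi> h) = return_pmf a" by auto
qed

theorem mainTheorem1:
  shows "(\<forall>\<pi> :: ('s::finite, 'a::finite) policy. deterministic \<pi> \<longrightarrow> specifiable \<pi>) \<and>
         (\<forall>\<pi> :: ('s, 'a) policy. specifiable \<pi> \<longrightarrow> deterministic \<pi>)"
  using deterministic_imp_specifiable specifiable_imp_deterministic by blast

end
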